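(* Let $K\subseteq\mathbb C$ be compact and $\varphi\in P(K)$. The following assertions are equivalent: (1) $\varphi$ is a generator for $P(K)$; that is, $P(K)=[\varphi]_{\rm alg}$; (2) $\varphi$ is a homeomorphism of $K$ onto $\varphi(K)$ and $\varphi^{-1}\in P(\varphi(K))$.
   Context: For a compact set $E\subseteq\mathbb C$, $P(E)$ is the uniform closure in $C(E)$ (complex-valued continuous functions on $E$) of the restrictions to $E$ of polynomials in $z$. $[\varphi]_{\rm alg}$ denotes the closed subalgebra generated by $\varphi$, i.e. the uniform closure on $K$ of $\{p\circ\varphi: p\in\mathbb C[z]\}$ (constants included). $\varphi^{-1}:\varphi(K)\to K\subseteq\mathbb C$ is the inverse function. *)

theory Defs
  imports "HOL-Analysis.Analysis"
begin

text \<open>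
  The elements of \<open>C(E)\<close> are the continuous functions on \<open>E\<close>, represented extensionally (they take
  the value \<^term>\<open>undefined\<close> off \<open>E\<close>), so that equality in \<open>C(E)\<close> is HOL equality. For
  compact \<open>E\<close> the boundedness built into \<^const>\<open>cfunspace\<close> holds automatically, and the metric
  is the supremum metric.
\<close>

definition C_space :: "complex set \<Rightarrow> (complex \<Rightarrow> complex) metric" where
  "C_space E = cfunspace (top_of_set E) euclidean_metric"

definition uniform_closure :: "complex set \<Rightarrow> (complex \<Rightarrow> complex) set \<Rightarrow> (complex \<Rightarrow> complex) set" where
  "uniform_closure E A = mtopology_of (C_space E) closure_of A"

definition P_alg :: "complex set \<Rightarrow> (complex \<Rightarrow> complex) set" where
  "P_alg E = uniform_closure E {restrict (poly p) E |p :: complex poly. True}"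

text \<open>
  \<^term>\<open>poly p\<close> includes constant \<open>p\<close>, so the algebra generated by \<open>\<phi>\<close> is the unital one.
\<close>

definition alg_gen :: "complex set \<Rightarrow> (complex \<Rightarrow> complex) \<Rightarrow> (complex \<Rightarrow> complex) set" where
  "alg_gen K \<phi> = uniform_closure K {restrict (poly p \<circ> \<phi>) K |p :: complex poly. True}"

lemma mem_uniform_closure_iff:
  assumes "compact E" and A: "A \<subseteq> mspace (C_space E)"
  shows "f \<in> uniform_closure E A \<longleftrightarrow>
    f \<in> extensional E \<and> continuous_on E f \<and>
    (\<forall>e>0. \<exists>g\<in>A. \<forall>z\<in>E. dist (f z) (g z) < e)"
proof -
  have sp: "f \<in> mspace (C_space E) \<longleftrightarrow> f \<in> extensional E \<and> continuous_on E f" for f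
    using \<open>compact E\<close> compactin_mspace_cfunspace[of "top_of_set E" "euclidean_metric :: complex metric"]
    by (auto simp: C_space_def simp del: mspace_cfunspace)
  have le: "mdist (C_space E) f g \<le> e" if "\<And>z. z \<in> E \<Longrightarrow> dist (f z) (g z) \<le> e" "0 \<le> e" for f g e
    using that mdist_cfunspace_le[of e "top_of_set E" euclidean_metric f g]
    by (simp add: C_space_def)
  have ge: "dist (f z) (g z) \<le> mdist (C_space E) f g"
    if "f \<in> mspace (C_space E)" "g \<in> mspace (C_space E)" "z \<in> E" for f g z
    using that mdist_cfunspace_imp_mdist_le[of f "top_of_set E" euclidean_metric g
        "mdist (C_space E) f g" z]
    by (simp add: C_space_def del: mspace_cfunspace)
  have cl: "f \<in> uniform_closure E A \<longleftrightarrow>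
      f \<in> mspace (C_space E) \<and> (\<forall>e>0. \<exists>g\<in>A. mdist (C_space E) f g < e)"
    unfolding uniform_closure_def mtopology_of_def
      Metric_space.metric_closure_of[OF Metric_space_mspace_mdist]
    using A by (auto simp: Metric_space.in_mball[OF Metric_space_mspace_mdist]) blast
  show ?thesis
  proof
    assume "f \<in> uniform_closure E A"
    then show "f \<in> extensional E \<and> continuous_on E f \<and>
        (\<forall>e>0. \<exists>g\<in>A. \<forall>z\<in>E. dist (f z) (g z) < e)"
      using cl sp ge A by (meson le_less_trans subsetD)
  next
    assume R: "f \<in> extensional E \<and> continuous_on E f \<and>
        (\<forall>e>0. \<exists>g\<in>A. \<forall>z\<in>E. dist (f z) (g z) < e)"
    have "\<exists>g\<in>A. mdist (C_space E) f g < e" if "e > 0" for e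
    proof -
      obtain g where g: "g \<in> A" "\<forall>z\<in>E. dist (f z) (g z) < e/2"
        using R \<open>e > 0\<close> half_gt_zero by blast
      then have "mdist (C_space E) f g \<le> e/2"
        using \<open>e > 0\<close> by (intro le) (auto intro: less_imp_le)
      then show ?thesis using g \<open>e > 0\<close> by (intro bexI[of _ g]) auto
    qed
    then show "f \<in> uniform_closure E A" using cl sp R by blast
  qed
qed

end

theory Submission
  imports Defs
begin

text \<open>
  Say that \<open>f\<close> is approximable by polynomials in \<open>g\<close> on \<open>E\<close> if it is a uniform limit of
  functions \<open>p \<circ> g\<close>. For bounded functions this relation is transitive, because polynomials are
  uniformly continuous on discs. As \<open>\<phi>\<close> is approximable in \<open>z\<close>, equality of the two algebras
  amounts to \<open>z\<close> being approximable in \<open>\<phi>\<close> on \<open>K\<close>. This forces \<open>\<phi>\<close> to be injective, and after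
  the substitution \<open>w = \<phi> z\<close> it says that \<open>\<phi>\<^sup>-\<^sup>1\<close> is approximable in \<open>w\<close> on \<open>\<phi>(K)\<close>.
\<close>

text \<open>Only values on \<open>E\<close> enter, and neither continuity nor extensionality is
  built in, so the relation can be pulled back along any map.\<close>

definition poly_approximable ::
    "'a set \<Rightarrow> ('a \<Rightarrow> 'b::{comm_semiring_0,metric_space}) \<Rightarrow> ('a \<Rightarrow> 'b) \<Rightarrow> bool" where
  "poly_approximable E f g \<longleftrightarrow> (\<forall>e>0. \<exists>p. \<forall>z\<in>E. dist (f z) (poly p (g z)) < e)"

lemma poly_approximable_cong:
  assumes "\<And>z. z \<in> E \<Longrightarrow> f z = f' z" and "\<And>z. z \<in> E \<Longrightarrow> g z = g' z"
  shows "poly_approximable E f g \<longleftrightarrow> poly_approximable E f' g'"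
  using assms by (simp add: poly_approximable_def)

lemma poly_approximable_image:
  "poly_approximable (h ` E) f g \<longleftrightarrow> poly_approximable E (f \<circ> h) (g \<circ> h)"
  by (simp add: poly_approximable_def)

lemma poly_approximable_trans:
  fixes f g h :: "'a \<Rightarrow> 'b::{real_normed_field,heine_borel}"
  assumes fg: "poly_approximable E f g" and gh: "poly_approximable E g h"
    and bdd: "bounded (g ` E)"
  shows "poly_approximable E f h"
  unfolding poly_approximable_def
proof (intro allI impI)
  fix e :: real
  assume "e > 0"
  then have "e/2 > 0"
    by simp
  then obtain p where p: "\<And>z. z \<in> E \<Longrightarrow> dist (f z) (poly p (g z)) < e/2"
    using fg unfolding poly_approximable_def by blast
  obtain B where B: "\<And>z. z \<in> E \<Longrightarrow> norm (g z) \<le> B"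
    using bdd by (auto simp: bounded_iff)
  \<comment> \<open>The extra 1 in the radius leaves room for \<open>poly q (h z)\<close>, which the
    bound \<open>min d 1\<close> keeps within distance 1 of \<open>g z\<close>.\<close>
  have "uniformly_continuous_on (cball 0 (B + 1)) (poly p)"
    by (intro compact_uniformly_continuous continuous_intros) auto
  then obtain d where "d > 0"
    and d: "\<And>x y. \<lbrakk>x \<in> cball 0 (B + 1); y \<in> cball 0 (B + 1); dist y x < d\<rbrakk>
              \<Longrightarrow> dist (poly p y) (poly p x) < e/2"
    using \<open>e/2 > 0\<close> unfolding uniformly_continuous_on_def by blast
  then have "min d 1 > 0"
    by simp
  then obtain q where q: "\<And>z. z \<in> E \<Longrightarrow> dist (g z) (poly q (h z)) < min d 1"
    using gh unfolding poly_approximable_def by blast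
  have "dist (f z) (poly (pcompose p q) (h z)) < e" if z: "z \<in> E" for z
  proof -
    have "norm (poly q (h z)) \<le> norm (g z) + dist (g z) (poly q (h z))"
      by (metis dist_norm norm_minus_commute norm_triangle_sub)
    then have "norm (poly q (h z)) \<le> B + 1"
      using B[OF z] q[OF z] by simp
    then have "dist (poly p (g z)) (poly p (poly q (h z))) < e/2"
      using B[OF z] q[OF z] by (intro d) auto
    then show ?thesis
      using p[OF z] dist_triangle[of "f z" "poly p (poly q (h z))" "poly p (g z)"]
      by (simp add: poly_pcompose)
  qed
  then show "\<exists>r. \<forall>z\<in>E. dist (f z) (poly r (h z)) < e"
    by blast
qed

text \<open>If \<open>g\<close> identified two distinct points, a single value
  \<open>poly p (g x)\<close> would lie within half their distance of both.\<close>

lemma poly_approximable_id_imp_inj_on: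
  assumes "poly_approximable E (\<lambda>z. z) g"
  shows "inj_on g E"
proof (rule inj_onI, rule ccontr)
  fix x y
  assume xy: "x \<in> E" "y \<in> E" "g x = g y" "x \<noteq> y"
  then obtain p where p: "\<And>z. z \<in> E \<Longrightarrow> dist z (poly p (g z)) < dist x y / 2"
    using assms unfolding poly_approximable_def by (meson half_gt_zero zero_less_dist_iff)
  have "dist x y < dist x y"
    using p[of x] p[of y] xy by (metis dist_triangle_half_l)
  then show False by simp
qed

lemma mem_alg_gen_iff:
  assumes "compact K" and "continuous_on K \<phi>"
  shows "f \<in> alg_gen K \<phi> \<longleftrightarrow>
    f \<in> extensional K \<and> continuous_on K f \<and> poly_approximable K f \<phi>"
proof -
  \<comment> \<open>The epsilon form of the closure presupposes that the generating set lies in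
    C(K).\<close>
  have "restrict (poly p \<circ> \<phi>) K \<in> mspace (C_space K)" for p
  proof -
    have "continuous_on K (restrict (poly p \<circ> \<phi>) K)"
      using assms(2) by (simp add: o_def cong: continuous_on_cong) (intro continuous_intros)
    then show ?thesis
      using \<open>compact K\<close> compactin_mspace_cfunspace[of "top_of_set K" "euclidean_metric :: complex metric"]
      by (auto simp: C_space_def simp del: mspace_cfunspace)
  qed
  then show ?thesis
    unfolding alg_gen_def poly_approximable_def
    by (subst mem_uniform_closure_iff[OF \<open>compact K\<close>]) fastforce+
qed

lemma P_alg_eq_alg_gen: "P_alg E = alg_gen E (\<lambda>z. z)"
  by (simp add: P_alg_def alg_gen_def o_def)

lemma mem_P_alg_iff:
  assumes "compact E"
  shows "f \<in> P_alg E \<longleftrightarrow>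
    f \<in> extensional E \<and> continuous_on E f \<and> poly_approximable E f (\<lambda>z. z)"
  using mem_alg_gen_iff[OF assms continuous_on_id] by (simp add: P_alg_eq_alg_gen)

text \<open>Equality is tested on the coordinate function, which lies in \<open>P_alg K\<close>.
  Conversely, transitivity applies both ways: through \<open>z\<close>, bounded on \<open>K\<close>,
  and through \<open>\<phi>\<close>, bounded as a continuous function on a compact set.\<close>

lemma P_alg_eq_alg_gen_iff:
  assumes K: "compact K" and \<phi>: "\<phi> \<in> P_alg K"
  shows "P_alg K = alg_gen K \<phi> \<longleftrightarrow> poly_approximable K (\<lambda>z. z) \<phi>"
proof -
  have cont: "continuous_on K \<phi>" and app: "poly_approximable K \<phi> (\<lambda>z. z)"
    using \<phi> K by (simp_all add: mem_P_alg_iff)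
  have bdd: "bounded (\<phi> ` K)" "bounded ((\<lambda>z. z) ` K)"
    using K cont by (auto intro: compact_imp_bounded compact_continuous_image)
  show ?thesis
  proof
    assume eq: "P_alg K = alg_gen K \<phi>"
    have "restrict (\<lambda>z. z) K \<in> P_alg K"
      using K by (auto simp: mem_P_alg_iff poly_approximable_def
          cong: continuous_on_cong intro!: exI[of _ "[:0, 1:]"])
    then have "poly_approximable K (restrict (\<lambda>z. z) K) \<phi>"
      using eq K cont by (simp add: mem_alg_gen_iff)
    then show "poly_approximable K (\<lambda>z. z) \<phi>"
      by (simp cong: poly_approximable_cong)
  next
    assume "poly_approximable K (\<lambda>z. z) \<phi>"
    then have "poly_approximable K f (\<lambda>z. z) \<longleftrightarrow> poly_approximable K f \<phi>" for f
      using app bdd poly_approximable_trans by blast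
    then show "P_alg K = alg_gen K \<phi>"
      using K cont by (auto simp: mem_P_alg_iff mem_alg_gen_iff)
  qed
qed

text \<open>Continuity of the inverse comes from compactness of the domain and the Hausdorff
  target.\<close>

lemma homeomorphism_inv_into_compact:
  fixes f :: "'a::topological_space \<Rightarrow> 'b::t2_space"
  assumes "compact S" "continuous_on S f" "inj_on f S"
  shows "homeomorphism S (f ` S) f (inv_into S f)"
  using assms by (auto simp: homeomorphism_def intro!: continuous_on_inv)

theorem theorem1p7:
  fixes K :: "complex set" and \<phi> :: "complex \<Rightarrow> complex"
  assumes "compact K" and "\<phi> \<in> P_alg K"
  shows "P_alg K = alg_gen K \<phi> \<longleftrightarrow>
    homeomorphism K (\<phi> ` K) \<phi> (inv_into K \<phi>) \<and>
    restrict (inv_into K \<phi>) (\<phi> ` K) \<in> P_alg (\<phi> ` K)"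
proof -
  have cont: "continuous_on K \<phi>"
    using assms by (simp add: mem_P_alg_iff)
  then have "compact (\<phi> ` K)"
    using assms(1) by (rule compact_continuous_image)
  \<comment> \<open>The homeomorphism supplies continuity of the inverse, so only approximability
    remains; pulled back along \<open>\<phi>\<close>, the inverse becomes \<open>z\<close> and the
    variable \<open>w\<close> becomes \<open>\<phi>\<close>.\<close>
  then have mem: "restrict (inv_into K \<phi>) (\<phi> ` K) \<in> P_alg (\<phi> ` K) \<longleftrightarrow>
      poly_approximable K (\<lambda>z. z) \<phi>" if hom: "homeomorphism K (\<phi> ` K) \<phi> (inv_into K \<phi>)"
    using hom by (simp add: mem_P_alg_iff poly_approximable_image homeomorphism_def
        cong: continuous_on_cong poly_approximable_cong)
  have "homeomorphism K (\<phi> ` K) \<phi> (inv_into K \<phi>)" if "poly_approximable K (\<lambda>z. z) \<phi>"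
    using assms(1) cont that
    by (intro homeomorphism_inv_into_compact poly_approximable_id_imp_inj_on)
  then show ?thesis
    using mem P_alg_eq_alg_gen_iff[OF assms] by blast
qed

end
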